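(* If $G$ is a GP$4$-graph, then $\gamma_{pr2}(G)=\frac{2}{5}|V(G)|$.
   Context: All graphs are finite and simple. A graph $G=(V,E)$ is a GP$4$-graph if it is obtained from a connected graph $H=(V_H,E_H)$ with $V_H=\{v_1,\dots,v_{n_H}\}$ by attaching a path to every vertex: $V=V_H\cup\{w_i,x_i,y_i,z_i : i\in[n_H]\}$ (new distinct vertices) and $E=E_H\cup\{v_iw_i,\,w_ix_i,\,x_iy_i,\,y_iz_i : i\in[n_H]\}$. For a graph $G$ with no isolated vertices, a semipaired dominating set is a set $D\subseteq V(G)$ such that every vertex outside $D$ has a neighbor in $D$ and $D$ can be partitioned into $2$-element subsets $\{u,v\}$ with the distance between $u$ and $v$ in $G$ at most $2$; $\gamma_{pr2}(G)$ denotes the minimum cardinality of a semipaired dominating set of $G$. *)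

theory Defs
  imports "Graph_Theory.Graph_Theory" "HOL-Library.Disjoint_Sets"
begin

text \<open>
  A finite simple graph is a \<^locale>\<open>pair_graph\<close>: a finite vertex set together with a symmetric,
  irreflexive set of ordered pairs of vertices. An edge \<open>uv\<close> is represented by the
  two pairs \<open>(u,v)\<close> and \<open>(v,u)\<close>.
\<close>

definition attach_P4 ::
  "'a pair_pre_digraph \<Rightarrow> ('a \<Rightarrow> 'a) \<Rightarrow> ('a \<Rightarrow> 'a) \<Rightarrow> ('a \<Rightarrow> 'a) \<Rightarrow> ('a \<Rightarrow> 'a) \<Rightarrow> 'a pair_pre_digraph"
where
  "attach_P4 H w x y z =
    (let P = (\<Union>v\<in>pverts H. {(v, w v), (w v, x v), (x v, y v), (y v, z v)})
     in \<lparr> pverts = pverts H \<union> w ` pverts H \<union> x ` pverts H \<union> y ` pverts H \<union> z ` pverts H,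
          parcs = parcs H \<union> P \<union> P\<inverse> \<rparr>)"

text \<open>
  The attached vertices are indexed by the vertices of \<open>H\<close> themselves instead of by an
  enumeration of them. The two conditions on \<open>w\<close>, \<open>x\<close>, \<open>y\<close>, \<open>z\<close> say that all attached
  vertices are pairwise distinct and different from the vertices of \<open>H\<close>. The library's
  connectedness requires a nonempty vertex set.
\<close>

definition GP4_graph :: "'a pair_pre_digraph \<Rightarrow> bool" where
  "GP4_graph G \<longleftrightarrow>
    (\<exists>H w x y z.
      pair_graph H \<and> Digraph_Component.connected (with_proj H) \<and>
      (\<forall>v\<in>pverts H. distinct [v, w v, x v, y v, z v]) \<and>
      (\<forall>u\<in>pverts H. \<forall>v\<in>pverts H. u \<noteq> v \<longrightarrow>
        {u, w u, x u, y u, z u} \<inter> {v, w v, x v, y v, z v} = {}) \<and>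
      G = attach_P4 H w x y z)"

definition graph_dist :: "'a pair_pre_digraph \<Rightarrow> 'a \<Rightarrow> 'a \<Rightarrow> ereal" where
  "graph_dist G u v = wf_digraph.\<mu> (with_proj G) (\<lambda>_. 1) u v"

definition dominating_set :: "'a pair_pre_digraph \<Rightarrow> 'a set \<Rightarrow> bool" where
  "dominating_set G D \<longleftrightarrow>
    D \<subseteq> pverts G \<and> (\<forall>u\<in>pverts G - D. \<exists>v\<in>D. (u, v) \<in> parcs G)"

definition semipaired_dominating_set :: "'a pair_pre_digraph \<Rightarrow> 'a set \<Rightarrow> bool" where
  "semipaired_dominating_set G D \<longleftrightarrow>
    dominating_set G D \<and>
    (\<exists>\<P>. partition_on D \<P> \<and>
      (\<forall>B\<in>\<P>. \<exists>u v. B = {u, v} \<and> u \<noteq> v \<and> graph_dist G u v \<le> 2))"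

text \<open>
  Only meaningful for finite graphs without isolated vertices; an isolated vertex rules out
  every semipaired dominating set.
\<close>

definition semipaired_domination_number :: "'a pair_pre_digraph \<Rightarrow> nat" (\<open>\<gamma>\<^sub>p\<^sub>r\<^sub>2\<close>) where
  "\<gamma>\<^sub>p\<^sub>r\<^sub>2 G = (LEAST k. \<exists>D. semipaired_dominating_set G D \<and> card D = k)"

lemma pair_graph_attach_P4:
  assumes "pair_graph H"
    and "\<forall>v\<in>pverts H. distinct [v, w v, x v, y v, z v]"
  shows "pair_graph (attach_P4 H w x y z)"
proof -
  interpret H: pair_graph H by fact
  define P where "P = (\<Union>v\<in>pverts H. {(v, w v), (w v, x v), (x v, y v), (y v, z v)})"
  let ?V = "pverts H \<union> w ` pverts H \<union> x ` pverts H \<union> y ` pverts H \<union> z ` pverts H"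
  let ?E = "parcs H \<union> P \<union> P\<inverse>"
  have G: "attach_P4 H w x y z = \<lparr> pverts = ?V, parcs = ?E \<rparr>"
    unfolding attach_P4_def P_def Let_def by (rule refl)
  have sym: "sym (parcs H)" using H.pair_sym_arcs by (simp add: symmetric_def)
  have fin: "finite P" by (simp add: P_def H.pair_finite_verts)
  have wf: "a \<in> ?V \<and> b \<in> ?V \<and> a \<noteq> b" if "(a, b) \<in> P" for a b
  proof -
    from that obtain v where v: "v \<in> pverts H"
      and ab: "(a, b) \<in> {(v, w v), (w v, x v), (x v, y v), (y v, z v)}"
      unfolding P_def by blast
    from assms(2) v have "distinct [v, w v, x v, y v, z v]" by (rule bspec)
    with ab have "a \<noteq> b" by auto
    moreover from ab have "a \<in> {v, w v, x v, y v, z v}" "b \<in> {v, w v, x v, y v, z v}" by blast+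
    ultimately show ?thesis using v by blast
  qed
  have wfH: "a \<in> ?V \<and> b \<in> ?V \<and> a \<noteq> b" if "(a, b) \<in> parcs H" for a b
    using H.wellformed'[OF that] H.pair_no_loops[OF that] by simp
  have E: "a \<in> ?V \<and> b \<in> ?V \<and> a \<noteq> b" if "(a, b) \<in> ?E" for a b
    proof -
    from that consider "(a, b) \<in> parcs H" | "(a, b) \<in> P" | "(b, a) \<in> P" by blast
    then show ?thesis
    proof cases
      case 1 then show ?thesis by (rule wfH)
    next
      case 2 then show ?thesis by (rule wf)
    next
      case 3
      then have "b \<in> ?V \<and> a \<in> ?V \<and> b \<noteq> a" by (rule wf)
      then show ?thesis by (elim conjE, intro conjI) (assumption | rule not_sym, assumption)+
    qed
  qed
  have "pair_graph \<lparr> pverts = ?V, parcs = ?E \<rparr>"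
  proof (unfold_locales, goal_cases)
    case (1 e) then show ?case using E[of "fst e" "snd e"] by simp
  next
    case (2 e) then show ?case using E[of "fst e" "snd e"] by simp
  next
    case 3 then show ?case by (simp add: H.pair_finite_verts)
  next
    case 4 then show ?case by (simp add: H.pair_finite_arcs fin)
  next
    case (5 e) then show ?case using E[of "fst e" "snd e"] by simp
  next
    case 6
    have "sym (P \<union> P\<inverse>)" by (rule sym_Un_converse)
    then have "sym ?E" using sym_Un[OF sym] by (simp add: Un_assoc)
    then show ?case by (simp add: symmetric_def)
  qed
  then show ?thesis by (simp only: G)
qed

lemma GP4_graph_pair_graph: "GP4_graph G \<Longrightarrow> pair_graph G"
  unfolding GP4_graph_def by (elim exE conjE) (simp only: pair_graph_attach_P4)

lemma GP4_graph_no_isolated: "GP4_graph G \<Longrightarrow> u \<in> pverts G \<Longrightarrow> \<exists>v. (u, v) \<in> parcs G"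
proof -
  assume "GP4_graph G" and u: "u \<in> pverts G"
  then obtain H w x y z where G: "G = attach_P4 H w x y z"
    unfolding GP4_graph_def by (elim exE conjE)
  let ?P = "\<Union>v\<in>pverts H. {(v, w v), (w v, x v), (x v, y v), (y v, z v)}"
  have V: "pverts G = pverts H \<union> w ` pverts H \<union> x ` pverts H \<union> y ` pverts H \<union> z ` pverts H"
    and E: "parcs G = parcs H \<union> ?P \<union> ?P\<inverse>"
    unfolding G attach_P4_def Let_def by (simp_all only: pair_pre_digraph.simps)
  from u[unfolded V] obtain v where v: "v \<in> pverts H" and "u \<in> {v, w v, x v, y v, z v}"
    by blast
  then have "\<exists>t. \<exists>v\<in>pverts H.
      (u, t) \<in> {(v, w v), (w v, x v), (x v, y v), (y v, z v)} \<or>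
      (t, u) \<in> {(v, w v), (w v, x v), (x v, y v), (y v, z v)}"
    by (elim insertE emptyE) blast+
  then show ?thesis unfolding E by (simp only: UN_iff Un_iff converse_iff) blast
qed

end

theory Submission
  imports Defs
begin

text \<open>
  The vertices \<open>w\<close> and \<open>y\<close> of all attached paths form a semipaired dominating set with two
  vertices per path. Conversely, dominating the end \<open>z\<close> of a path forces \<open>y\<close> or \<open>z\<close> into every
  dominating set, and all vertices within distance 2 of \<open>y\<close> or of \<open>z\<close> lie on the same attached
  path, so the partner of that vertex gives a second vertex on each path.
\<close>

lemma graph_dist_le_2I:
  assumes "wf_digraph (with_proj G)" and "(u, t) \<in> parcs G" and "(t, v) \<in> parcs G"
  shows "graph_dist G u v \<le> 2"
proof -
  interpret wf_digraph "with_proj G" by fact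
  have "awalk u [(u, t), (t, v)] v"
    using assms(2,3) wellformed[of "(u, t)"] wellformed[of "(t, v)"] by (simp add: awalk_def)
  then have "\<mu> (\<lambda>_. 1) u v \<le> ereal (awalk_cost (\<lambda>_. 1) [(u, t), (t, v)])"
    by (rule min_cost_le_walk_cost)
  then show ?thesis by (simp add: graph_dist_def awalk_cost_def)
qed

lemma graph_dist_le_2D:
  assumes "wf_digraph (with_proj G)" and "graph_dist G u v \<le> 2"
  shows "u = v \<or> (u, v) \<in> parcs G \<or> (\<exists>t. (u, t) \<in> parcs G \<and> (t, v) \<in> parcs G)"
proof -
  interpret wf_digraph "with_proj G" by fact
  \<comment> \<open>The distance is an infimum of walk costs, so a strict bound is what yields an
    actual walk. With unit costs, a cost below 3 means at most two arcs.\<close>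
  have "\<mu> (\<lambda>_. 1) u v < ereal 3"
    using assms(2) unfolding graph_dist_def by (rule le_less_trans) simp
  then obtain p where p: "awalk u p v" and "ereal (awalk_cost (\<lambda>_. 1) p) < ereal 3"
    unfolding \<mu>_def by (auto simp: INF_less_iff)
  then have "length p < 3" by (simp add: awalk_cost_def sum_list_triv)
  then consider "p = []" | e where "p = [e]" | e f where "p = [e, f]"
    by (auto simp: numeral_eq_Suc less_Suc_eq length_Suc_conv)
  then show ?thesis
    using p by cases (auto simp: awalk_def)
qed

text \<open>Names the witnesses that \<open>GP4_graph\<close> hides behind existential quantifiers,
  so that the argument can proceed path by path.\<close>

locale P4_attachment =
  fixes H :: "'a pair_pre_digraph" and w x y z :: "'a \<Rightarrow> 'a"
  assumes pair_graph: "pair_graph H"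
    and distinct: "\<forall>v\<in>pverts H. distinct [v, w v, x v, y v, z v]"
    and disjoint: "\<forall>u\<in>pverts H. \<forall>v\<in>pverts H. u \<noteq> v \<longrightarrow>
        {u, w u, x u, y u, z u} \<inter> {v, w v, x v, y v, z v} = {}"
begin

abbreviation G :: "'a pair_pre_digraph" where
  "G \<equiv> attach_P4 H w x y z"

text \<open>The base vertex in \<open>H\<close> is included, so that the legs partition
  \<open>pverts G\<close> and cardinalities can be summed leg by leg.\<close>

definition leg :: "'a \<Rightarrow> 'a set" where
  "leg v = {v, w v, x v, y v, z v}"

lemma wf_digraph: "wf_digraph (with_proj G)"
proof -
  interpret pair_graph G by (rule pair_graph_attach_P4[OF pair_graph distinct])
  show ?thesis by (rule wf_digraph_axioms)
qed

lemma finite: "finite (pverts H)"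
proof -
  interpret pair_graph H by (rule pair_graph)
  show ?thesis by (rule pair_finite_verts)
qed

lemma pverts_eq: "pverts G = (\<Union>v\<in>pverts H. leg v)"
  by (auto simp: attach_P4_def Let_def leg_def)

lemma path_arc:
  assumes "v \<in> pverts H"
    and "(a, b) \<in> {(v, w v), (w v, x v), (x v, y v), (y v, z v)}"
  shows "(a, b) \<in> parcs G" "(b, a) \<in> parcs G"
  using assms unfolding attach_P4_def Let_def by auto

lemma leg_disjoint: "u \<in> pverts H \<Longrightarrow> v \<in> pverts H \<Longrightarrow> u \<noteq> v \<Longrightarrow> leg u \<inter> leg v = {}"
  using disjoint unfolding leg_def by blast

lemma leg_neq:
  assumes "v \<in> pverts H"
  shows "v \<noteq> w v" "v \<noteq> x v" "v \<noteq> y v" "v \<noteq> z v" "w v \<noteq> x v" "w v \<noteq> y v" "w v \<noteq> z v"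
    "x v \<noteq> y v" "x v \<noteq> z v" "y v \<noteq> z v"
  using bspec[OF distinct assms] by auto

lemma finite_leg: "finite (leg v)"
  by (simp add: leg_def)

lemma card_leg: "v \<in> pverts H \<Longrightarrow> card (leg v) = 5"
  using leg_neq[of v] by (simp add: leg_def)

lemma card_pverts: "card (pverts G) = 5 * card (pverts H)"
proof -
  have "card (pverts G) = (\<Sum>v\<in>pverts H. card (leg v))"
    unfolding pverts_eq by (rule card_UN_disjoint) (auto simp: finite finite_leg leg_disjoint)
  then show ?thesis by (simp add: card_leg)
qed

text \<open>An arc of \<open>H\<close> at \<open>a\<close> would put \<open>a\<close> into
  \<open>pverts H\<close>, hence into its own leg as base vertex, and disjointness of the legs would
  force \<open>a = v\<close>. A path arc at \<open>a\<close> belongs to the leg containing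
  \<open>a\<close>, which is again that of \<open>v\<close>.\<close>

lemma parcs_cases:
  assumes "(a, b) \<in> parcs G" and v: "v \<in> pverts H" and a: "a \<in> leg v" "a \<noteq> v"
  shows "(a, b) \<in> {(v, w v), (w v, x v), (x v, y v), (y v, z v)} \<or>
    (b, a) \<in> {(v, w v), (w v, x v), (x v, y v), (y v, z v)}"
proof -
  interpret H: pair_graph H by (rule pair_graph)
  have unique: "u = v" if "u \<in> pverts H" "a \<in> leg u" for u
    using leg_disjoint[OF that(1) v] that(2) a(1) by blast
  have "(a, b) \<notin> parcs H"
    using H.wellformed'[of a b] unique[of a] a(2) by (auto simp: leg_def)
  then obtain u where u: "u \<in> pverts H" and
    ab: "(a, b) \<in> {(u, w u), (w u, x u), (x u, y u), (y u, z u)} \<or>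
      (b, a) \<in> {(u, w u), (w u, x u), (x u, y u), (y u, z u)}"
    using assms(1) unfolding attach_P4_def Let_def by auto
  then have "a \<in> leg u" by (auto simp: leg_def)
  with ab unique[OF u] show ?thesis by blast
qed

lemma neighbor_x: "(x v, b) \<in> parcs G \<Longrightarrow> v \<in> pverts H \<Longrightarrow> b \<in> {w v, y v}"
  using parcs_cases[of "x v" b v] leg_neq[of v] by (auto simp: leg_def)

lemma neighbor_y: "(y v, b) \<in> parcs G \<Longrightarrow> v \<in> pverts H \<Longrightarrow> b \<in> {x v, z v}"
  using parcs_cases[of "y v" b v] leg_neq[of v] by (auto simp: leg_def)

lemma neighbor_z: "(z v, b) \<in> parcs G \<Longrightarrow> v \<in> pverts H \<Longrightarrow> b = y v"
  using parcs_cases[of "z v" b v] leg_neq[of v] by (auto simp: leg_def)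

lemma parcs_sym: "(a, b) \<in> parcs G \<Longrightarrow> (b, a) \<in> parcs G"
proof -
  interpret pair_graph G by (rule pair_graph_attach_P4[OF pair_graph distinct])
  show "(a, b) \<in> parcs G \<Longrightarrow> (b, a) \<in> parcs G" using arcs_symmetric by blast
qed

text \<open>Two steps from \<open>y v\<close> reach at most \<open>w v\<close>, and two steps from
  \<open>z v\<close> at most \<open>x v\<close>, so the base vertex is never passed. Both orders of
  \<open>a\<close> and \<open>b\<close> are covered because a block \<open>{u, v}\<close> of the
  pairing does not tell which of its elements is \<open>a\<close>.\<close>

lemma graph_dist_le_2_leg:
  assumes v: "v \<in> pverts H" and a: "a \<in> {y v, z v}"
    and "graph_dist G a b \<le> 2 \<or> graph_dist G b a \<le> 2"
  shows "b \<in> leg v"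
proof -
  have "a = b \<or> (a, b) \<in> parcs G \<or> (\<exists>t. (a, t) \<in> parcs G \<and> (t, b) \<in> parcs G)"
    using assms(3) graph_dist_le_2D[OF wf_digraph] parcs_sym by metis
  with a show ?thesis
    by (auto simp: leg_def dest: neighbor_x[OF _ v] neighbor_y[OF _ v] neighbor_z[OF _ v])
qed

lemma card_Int_leg:
  assumes D: "semipaired_dominating_set G D" and v: "v \<in> pverts H"
  shows "2 \<le> card (D \<inter> leg v)"
proof -
  have "z v \<in> pverts G" using v by (auto simp: pverts_eq leg_def)
  with D obtain a where a: "a \<in> D" "a \<in> {y v, z v}"
    unfolding semipaired_dominating_set_def dominating_set_def
    using neighbor_z[OF _ v] by blast
  from D obtain \<P> where P: "partition_on D \<P>"
    and dist: "\<forall>B\<in>\<P>. \<exists>u v. B = {u, v} \<and> u \<noteq> v \<and> graph_dist G u v \<le> 2"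
    unfolding semipaired_dominating_set_def by blast
  from a(1) P obtain B where B: "B \<in> \<P>" "a \<in> B" "B \<subseteq> D"
    unfolding partition_on_def by blast
  \<comment> \<open>The other element of the two-element block containing \<open>a\<close>.\<close>
  with dist obtain b where b: "b \<in> D" "b \<noteq> a" "graph_dist G a b \<le> 2 \<or> graph_dist G b a \<le> 2"
    by (metis insertE insert_subset singletonD)
  have "{a, b} \<subseteq> D \<inter> leg v"
    using a b graph_dist_le_2_leg[OF v a(2) b(3)] by (auto simp: leg_def)
  then have "card {a, b} \<le> card (D \<inter> leg v)"
    by (rule card_mono[rotated]) (simp add: finite_leg)
  with b(2) show ?thesis by simp
qed

lemma card_semipaired_dominating_set_ge:
  assumes D: "semipaired_dominating_set G D"
  shows "2 * card (pverts H) \<le> card D"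
proof -
  \<comment> \<open>The traces of \<open>D\<close> on the disjoint legs partition \<open>D\<close>,
    so the bound of two per leg adds up.\<close>
  have "D = (\<Union>v\<in>pverts H. D \<inter> leg v)"
    using D unfolding semipaired_dominating_set_def dominating_set_def pverts_eq by blast
  then have "card D = card (\<Union>v\<in>pverts H. D \<inter> leg v)" by simp
  also have "\<dots> = (\<Sum>v\<in>pverts H. card (D \<inter> leg v))"
    using leg_disjoint by (intro card_UN_disjoint) (auto simp: finite finite_leg)
  also have "\<dots> \<ge> (\<Sum>v\<in>pverts H. 2)"
    by (rule sum_mono) (rule card_Int_leg[OF D])
  finally show ?thesis by simp
qed

lemma wy_disjoint:
  assumes "u \<in> pverts H" "v \<in> pverts H" "u \<noteq> v"
  shows "{w u, y u} \<inter> {w v, y v} = {}"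
  using leg_disjoint[OF assms] by (auto simp: leg_def)

lemma semipaired_dominating_set_wy:
  "semipaired_dominating_set G (\<Union>v\<in>pverts H. {w v, y v})"
  unfolding semipaired_dominating_set_def
proof (intro conjI exI)
  show "dominating_set G (\<Union>v\<in>pverts H. {w v, y v})"
    unfolding dominating_set_def
  proof (intro conjI ballI)
    show "(\<Union>v\<in>pverts H. {w v, y v}) \<subseteq> pverts G" by (auto simp: pverts_eq leg_def)
  next
    fix u assume u: "u \<in> pverts G - (\<Union>v\<in>pverts H. {w v, y v})"
    then obtain v where v: "v \<in> pverts H" and "u \<in> {v, x v, z v}"
      by (auto simp: pverts_eq leg_def)
    \<comment> \<open>\<open>w v\<close> dominates \<open>v\<close> and \<open>x v\<close>, while
      \<open>y v\<close> dominates \<open>z v\<close>.\<close>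
    then have "(u, w v) \<in> parcs G \<or> (u, y v) \<in> parcs G"
      using path_arc[OF v, of v "w v"] path_arc[OF v, of "w v" "x v"]
        path_arc[OF v, of "y v" "z v"] by auto
    with v show "\<exists>t\<in>\<Union>v\<in>pverts H. {w v, y v}. (u, t) \<in> parcs G" by blast
  qed
  show "partition_on (\<Union>v\<in>pverts H. {w v, y v}) ((\<lambda>v. {w v, y v}) ` pverts H)"
    using wy_disjoint by (intro partition_onI) (auto simp: disjnt_def)
  \<comment> \<open>Each pair is joined through the middle vertex \<open>x v\<close>.\<close>
  have "graph_dist G (w v) (y v) \<le> 2" if "v \<in> pverts H" for v
    using path_arc[OF that] by (intro graph_dist_le_2I[OF wf_digraph, of _ "x v"]) auto
  then show "\<forall>B\<in>(\<lambda>v. {w v, y v}) ` pverts H. \<exists>u v. B = {u, v} \<and> u \<noteq> v \<and> graph_dist G u v \<le> 2"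
    using leg_neq(6) by blast
qed

lemma card_wy: "card (\<Union>v\<in>pverts H. {w v, y v}) = 2 * card (pverts H)"
proof -
  have "card (\<Union>v\<in>pverts H. {w v, y v}) = (\<Sum>v\<in>pverts H. card {w v, y v})"
    using wy_disjoint by (intro card_UN_disjoint) (simp_all add: finite)
  then show ?thesis by (simp add: leg_neq(6))
qed

lemma semipaired_domination_number_eq: "\<gamma>\<^sub>p\<^sub>r\<^sub>2 G = 2 * card (pverts H)"
  unfolding semipaired_domination_number_def
proof (rule Least_equality)
  show "\<exists>D. semipaired_dominating_set G D \<and> card D = 2 * card (pverts H)"
    using semipaired_dominating_set_wy card_wy by blast
qed (use card_semipaired_dominating_set_ge in blast)

end

theorem theorem1:
  fixes G :: "'a pair_pre_digraph"
  assumes "GP4_graph G"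
  shows "real (\<gamma>\<^sub>p\<^sub>r\<^sub>2 G) = 2 / 5 * real (card (pverts G))"
proof -
  from assms obtain H w x y z where "P4_attachment H w x y z" and G: "G = attach_P4 H w x y z"
    unfolding GP4_graph_def P4_attachment_def by blast
  then interpret P4_attachment H w x y z by blast
  show ?thesis
    \<comment> \<open>Each leg accounts for two of the chosen vertices and five vertices of
      \<open>G\<close>, whence the ratio 2/5.\<close>
    by (simp add: G semipaired_domination_number_eq card_pverts)
qed

end
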